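(* Let $P$ be a poset whose order is the intersection of finitely many scattered linear orders on the underlying set of $P$. Then $P$ contains no isomorphic copy (as an induced subposet) of any of the posets $\eta$, $T_2$, $\Omega(\eta)$, $B(\check{\eta})$, $B(\check{T_2})$, $B(\check{\Omega}(\eta))$, nor of any of their duals.
   Context: A poset (or its order) is scattered if it contains no induced subposet isomorphic to the chain $\eta$ of rational numbers. The dual $P^*$ of a poset $P$ is the same set with the reversed order. $\eta$ denotes the chain $(\mathbb{Q},\leq)$. $T_2$ is the infinite binary tree: the set of finite $0$-$1$ sequences (including the empty one), ordered by $s\leq t$ iff $s$ is an initial segment of $t$ (so the root is the least element). $\Omega(\eta)$ is the infinite binary tree in which each level is totally ordered increasingly from left to right: its underlying set is the set of finite $0$-$1$ sequences, and its order is the least order containing the order of $T_2$ and, for sequences of equal length, the lexicographic order ($0<1$). Equivalently, $\Omega(\eta)$ is isomorphic to $\{(n, m/2^n): n,m\in\mathbb{N},\ 0\leq m<2^n\}$ ordered by $(n,a)\leq(n',a')$ iff $n\leq n'$ and $a\leq a'$. For a poset $P$, the open split $B(\check{P})$ is the poset on $P\times\{0,1\}$ with strict order $(x,i)<(y,j)$ iff $i<j$ and $x<y$ in $P$. $B(\check{\Omega}(\eta))$ is the open split of $\Omega(\eta)$. *)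

theory Defs
  imports Complex_Main "HOL-Library.Sublist"
begin

text \<open>
  An order is a reflexive relation of type \<^typ>\<open>'a rel\<close>; the underlying set of the poset is its
  field, and the dual poset is the converse relation \<open>r\<inverse>\<close>.
\<close>

definition contains_copy :: "'a rel \<Rightarrow> 'b rel \<Rightarrow> bool" where
  "contains_copy r q \<longleftrightarrow> (\<exists>S \<subseteq> Field r. \<exists>f. iso q (Restr r S) f)"

definition eta :: "rat rel" where
  "eta = {(x, y). x \<le> y}"

definition scattered :: "'a rel \<Rightarrow> bool" where
  "scattered r \<longleftrightarrow> \<not> contains_copy r eta"

text \<open>Finite 0-1 sequences are Boolean lists, with \<open>False\<close> for 0 and \<open>True\<close> for 1.\<close>

definition T2 :: "bool list rel" where
  "T2 = {(s, t). prefix s t}"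

text \<open>
  \<^const>\<open>lex\<close> is the strict lexicographic order and relates only lists of equal length. The
  lemma after the definition shows that the reflexive transitive closure is indeed the least order.
\<close>

definition Omega_eta :: "bool list rel" where
  "Omega_eta = (T2 \<union> lex {(False, True)})\<^sup>*"

lemma Omega_eta_least_order:
  shows "partial_order_on UNIV Omega_eta"
    and "T2 \<subseteq> Omega_eta" and "lex {(False, True)} \<subseteq> Omega_eta"
    and "\<lbrakk>partial_order_on UNIV r; T2 \<subseteq> r; lex {(False, True)} \<subseteq> r\<rbrakk> \<Longrightarrow> Omega_eta \<subseteq> r"
proof -
  let ?l = "lex {(False, True)}"
  have tr: "trans ?l"
    by (rule lex_transI) (simp add: trans_def)
  have irr: "(s, s) \<notin> ?l" for s
    using lexord_irreflexive[of "{(False, True)}" s] by (simp add: lexord_lex)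
  have len: "length s = length t" if "(s, t) \<in> ?l" for s t
    using that by (auto simp: lex_conv)
  have inv: "length s \<le> length t \<and> (length s = length t \<longrightarrow> s = t \<or> (s, t) \<in> ?l)"
    if "(s, t) \<in> Omega_eta" for s t
    using that unfolding Omega_eta_def
  proof (induction rule: rtrancl_induct)
    case base
    show ?case by simp
  next
    case (step t u)
    from step.hyps(2) consider "prefix t u" | "(t, u) \<in> ?l"
      by (auto simp: T2_def)
    then show ?case
    proof cases
      case 1
      then have le: "length t \<le> length u" by (rule prefix_length_le)
      have "t = u" if "length t = length u"
        using 1 that by (auto simp: prefix_def)
      with step.IH le show ?thesis by (metis le_antisym le_trans)
    next
      case 2
      with step.IH len[OF 2] show ?thesis using transD[OF tr] by metis
    qed
  qed
  have "antisym Omega_eta"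
  proof (rule antisymI)
    fix s t assume a: "(s, t) \<in> Omega_eta" "(t, s) \<in> Omega_eta"
    then show "s = t"
      using inv[OF a(1)] inv[OF a(2)] irr transD[OF tr] by (metis le_antisym)
  qed
  then show "partial_order_on UNIV Omega_eta"
    by (simp add: partial_order_on_def preorder_on_def Omega_eta_def refl_rtrancl trans_rtrancl)
  show "T2 \<subseteq> Omega_eta" "?l \<subseteq> Omega_eta"
    by (auto simp: Omega_eta_def)
  show "Omega_eta \<subseteq> r" if "partial_order_on UNIV r" "T2 \<subseteq> r" "?l \<subseteq> r"
  proof -
    have "refl r" "trans r"
      using that(1) by (auto simp: partial_order_on_def preorder_on_def)
    have "(s, t) \<in> r" if "(s, t) \<in> Omega_eta" for s t
      using that unfolding Omega_eta_def
    proof (induction rule: rtrancl_induct)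
      case base
      show ?case using \<open>refl r\<close> by (simp add: refl_on_def)
    next
      case (step t u)
      with \<open>T2 \<subseteq> r\<close> \<open>?l \<subseteq> r\<close> show ?case using transD[OF \<open>trans r\<close>] by blast
    qed
    then show ?thesis by auto
  qed
qed

text \<open>The copies \<open>P \<times> {0}\<close> and \<open>P \<times> {1}\<close> are tagged by \<open>False\<close> and \<open>True\<close>.\<close>

definition open_split :: "'a rel \<Rightarrow> ('a \<times> bool) rel" where
  "open_split r = Id_on (Field r \<times> UNIV) \<union>
     {((x, i), (y, j)) | x i y j. i < j \<and> (x, y) \<in> r \<and> x \<noteq> y}"

end

theory Submission
  imports Defs "HOL-Analysis.Continuum_Not_Denumerable" "HOL-Analysis.Finite_Cartesian_Product"
begin

text \<open>
  Write \<open>x < y\<close> in \<open>Q\<close> as \<open>\<forall>l. f x <\<^sub>l g y\<close>: for a copy of \<open>Q\<close> itself \<open>f = g\<close>, and for a copy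
  of the open split \<open>f\<close> and \<open>g\<close> are the restrictions to the two levels. If \<open>X\<close> is a down-set of
  \<open>Q\<close> in which every finite subset has a strict upper bound, then \<open>X\<close> can be recovered from the
  initial segments generated by \<open>f ` X\<close> in the orders \<open>l\<close>. A countable scattered chain has only
  countably many initial segments, so there are only countably many such \<open>X\<close>. But \<open>\<eta>\<close> has
  continuum many (real cuts), and so have \<open>T\<^sub>2\<close> and \<open>\<Omega>(\<eta>)\<close> (the down-sets generated by the
  infinite branches).
\<close>

section \<open>Copies as order embeddings, and duals\<close>

text \<open>\<open>iso\<close> is defined through \<open>embed\<close>, which maps each
  \<open>under q a\<close> bijectively onto the \<open>under\<close> set of the image. As
  \<open>x\<close> lies below \<open>y\<close> iff \<open>x\<close> is in \<open>under q y\<close>,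
  an injective map of this kind preserves and reflects the order.\<close>

lemma contains_copyE:
  assumes "contains_copy r q"
  obtains f where "inj_on f (Field q)" "f ` Field q \<subseteq> Field r"
    "\<And>x y. x \<in> Field q \<Longrightarrow> y \<in> Field q \<Longrightarrow> (x, y) \<in> q \<longleftrightarrow> (f x, f y) \<in> r"
proof -
  from assms obtain S f where S: "S \<subseteq> Field r" and iso: "iso q (Restr r S) f"
    unfolding contains_copy_def by blast
  have bij: "bij_betw f (Field q) (Field (Restr r S))"
    and emb: "\<And>a. a \<in> Field q \<Longrightarrow> bij_betw f (under q a) (under (Restr r S) (f a))"
    using iso by (auto simp: iso_def embed_def)
  have inj: "inj_on f (Field q)" using bij by (rule bij_betw_imp_inj_on)
  have im: "f ` Field q = Field (Restr r S)" using bij by (rule bij_betw_imp_surj_on)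
  also have FS: "\<dots> \<subseteq> S" by (auto simp: Field_def)
  finally have fS: "f ` Field q \<subseteq> S" .
  have "(x, y) \<in> q \<longleftrightarrow> (f x, f y) \<in> r" if x: "x \<in> Field q" and y: "y \<in> Field q" for x y
  proof -
    have *: "f ` under q y = under (Restr r S) (f y)"
      using emb[OF y] by (rule bij_betw_imp_surj_on)
    have "under q y \<subseteq> Field q" by (auto simp: under_def Field_def)
    then have "x \<in> under q y \<longleftrightarrow> f x \<in> f ` under q y"
      using inj x by (auto dest: inj_onD)
    then show ?thesis using * fS x y by (auto simp: under_def)
  qed
  with inj fS S show thesis by (intro that[of f]) auto
qed

text \<open>Reflexivity makes the image of \<open>f\<close> the whole field of the relation
  restricted to it, as \<open>iso\<close> demands.\<close>

lemma contains_copyI: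
  assumes "refl_on (Field q) q" and inj: "inj_on f (Field q)"
    and iff: "\<And>x y. x \<in> Field q \<Longrightarrow> y \<in> Field q \<Longrightarrow> (x, y) \<in> q \<longleftrightarrow> (f x, f y) \<in> r"
  shows "contains_copy r q"
proof -
  let ?S = "f ` Field q"
  have refl: "(f x, f x) \<in> r" if "x \<in> Field q" for x
    using that iff[of x x] assms(1) by (auto simp: refl_on_def)
  then have F: "Field (Restr r ?S) = ?S" by (auto simp: Field_def)
  have "bij_betw f (under q a) (under (Restr r ?S) (f a))" if a: "a \<in> Field q" for a
  proof -
    have sub: "under q a \<subseteq> Field q" by (auto simp: under_def Field_def)
    have "f ` under q a = under (Restr r ?S) (f a)"
    proof (intro set_eqI iffI)
      fix z assume "z \<in> f ` under q a"
      then show "z \<in> under (Restr r ?S) (f a)"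
        using sub iff a by (fastforce simp: under_def)
    next
      fix z assume "z \<in> under (Restr r ?S) (f a)"
      then show "z \<in> f ` under q a"
        using iff a by (auto simp: under_def)
    qed
    then show ?thesis using inj sub by (auto simp: bij_betw_def intro: inj_on_subset)
  qed
  then have "iso q (Restr r ?S) f"
    using inj F by (auto simp: iso_def embed_def bij_betw_def)
  moreover have "?S \<subseteq> Field r" using refl by (auto simp: Field_def)
  ultimately show ?thesis unfolding contains_copy_def by blast
qed

lemma contains_copy_converse:
  assumes "refl_on (Field q) q" and "contains_copy r (q\<inverse>)"
  shows "contains_copy (r\<inverse>) q"
  using assms(2)
proof (rule contains_copyE)
  fix f assume "inj_on f (Field (q\<inverse>))"
    and "\<And>x y. x \<in> Field (q\<inverse>) \<Longrightarrow> y \<in> Field (q\<inverse>) \<Longrightarrow> (x, y) \<in> q\<inverse> \<longleftrightarrow> (f x, f y) \<in> r"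
  then show ?thesis using assms(1) by (intro contains_copyI[of q f]) auto
qed

lemma Field_eta [simp]: "Field eta = UNIV"
  by (auto simp: eta_def Field_def)

text \<open>Negation is an isomorphism of \<open>eta\<close> onto its dual.\<close>

lemma scattered_converse:
  assumes "scattered r"
  shows "scattered (r\<inverse>)"
  unfolding scattered_def
proof
  assume "contains_copy (r\<inverse>) eta"
  then obtain f where inj: "inj f"
    and f: "\<And>x y. (x, y) \<in> eta \<longleftrightarrow> (f x, f y) \<in> r\<inverse>"
    by (auto elim: contains_copyE)
  have "contains_copy r eta"
  proof (rule contains_copyI[where f = "\<lambda>x. f (- x)"])
    show "refl_on (Field eta) eta" by (auto simp: eta_def refl_on_def)
    show "inj_on (\<lambda>x. f (- x)) (Field eta)"
      using injD[OF inj] by (intro inj_onI) (metis neg_equal_iff_equal)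
    show "(x, y) \<in> eta \<longleftrightarrow> (f (- x), f (- y)) \<in> r" for x y
      using f[of "- y" "- x"] by (auto simp: eta_def)
  qed
  with assms show False by (simp add: scattered_def)
qed

section \<open>Initial segments of countable scattered chains\<close>

text \<open>The forth half of Cantor's back-and-forth: the rationals are treated in the order of
  their codes \<open>to_nat\<close>, and density supplies a value between those of the neighbours
  treated before. Keeping all values strictly between \<open>u\<close> and \<open>v\<close> leaves
  room at both ends.\<close>

lemma rat_into_dense_relation:
  assumes trans: "\<And>x y z. R x y \<Longrightarrow> R y z \<Longrightarrow> R x z"
    and dense: "\<And>x y. R x y \<Longrightarrow> \<exists>z. R x z \<and> R z y"
    and uv: "R u v"
  obtains h :: "rat \<Rightarrow> 'a" where "\<And>p q. p < q \<Longrightarrow> R (h p) (h q)"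
proof -
  \<comment> \<open>\<open>P h q r\<close> says that \<open>r\<close> is an admissible value at
    \<open>q\<close>, given the values of \<open>h\<close> at the rationals of smaller code.\<close>
  define P where "P h q r \<longleftrightarrow> R u r \<and> R r v \<and>
    (\<forall>p. to_nat p < to_nat q \<longrightarrow> (p < q \<longrightarrow> R (h p) r) \<and> (q < p \<longrightarrow> R r (h p)))"
    for h :: "rat \<Rightarrow> 'a" and q r
  have "\<exists>h. \<forall>q. P h q (h q)"
  proof (rule dependent_wf_choice[of "inv_image less_than (to_nat :: rat \<Rightarrow> nat)" P])
    show "wf (inv_image less_than (to_nat :: rat \<Rightarrow> nat))" by simp
    show "P f x r = P g x r"
      if "\<And>z. (z, x) \<in> inv_image less_than to_nat \<Longrightarrow> f z = g z" for f g x r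
      using that by (auto simp: P_def)
  next
    fix q :: rat and h :: "rat \<Rightarrow> 'a"
    assume IH: "\<And>p. (p, q) \<in> inv_image less_than to_nat \<Longrightarrow> P h p (h p)"
    have uv': "R u (h p)" "R (h p) v" if "to_nat p < to_nat q" for p
      using IH that by (auto simp: P_def)
    have mono: "R (h p) (h p')" if "to_nat p < to_nat q" "to_nat p' < to_nat q" "p < p'" for p p'
      using IH[of p] IH[of p'] that by (cases "to_nat p < to_nat p'") (auto simp: P_def not_less le_less)
    define S where "S = {p. to_nat p < to_nat q \<and> p < q}"
    define T where "T = {p. to_nat p < to_nat q \<and> q < p}"
    have "finite {p :: rat. to_nat p < to_nat q}"
      using finite_vimageI[of "{..<to_nat q}" "to_nat :: rat \<Rightarrow> nat"] by (simp add: vimage_def)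
    then have fin: "finite S" "finite T" by (auto simp: S_def T_def)
    \<comment> \<open>The values at the two neighbours of \<open>q\<close> among the earlier
      rationals; \<open>u\<close> and \<open>v\<close> stand in where there is no neighbour.\<close>
    define a where "a = (if S = {} then u else h (Max S))"
    define b where "b = (if T = {} then v else h (Min T))"
    have MS: "Max S \<in> S" if "S \<noteq> {}" using that fin by simp
    have MT: "Min T \<in> T" if "T \<noteq> {}" using that fin by simp
    have "R a b"
      using MS MT uv uv' mono by (force simp: a_def b_def S_def T_def)
    then obtain r where r: "R a r" "R r b" using dense by blast
    have ua: "R u a \<or> u = a" and bv: "R b v \<or> b = v"
      using MS MT uv' by (auto simp: a_def b_def S_def T_def)
    have "R (h p) r" if "p \<in> S" for p
    proof -
      have "S \<noteq> {}" using that by auto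
      moreover from this have "p \<le> Max S" "Max S \<in> S" using that fin MS by auto
      ultimately have "R (h p) a \<or> h p = a"
        using mono[of p "Max S"] that by (auto simp: a_def S_def le_less)
      then show ?thesis using r trans by blast
    qed
    moreover have "R r (h p)" if "p \<in> T" for p
    proof -
      have "T \<noteq> {}" using that by auto
      moreover from this have "Min T \<le> p" "Min T \<in> T" using that fin MT by auto
      ultimately have "R b (h p) \<or> h p = b"
        using mono[of "Min T" p] that by (auto simp: b_def T_def le_less)
      then show ?thesis using r trans by blast
    qed
    moreover have "R u r" "R r v" using ua bv r trans by blast+
    ultimately show "\<exists>r. P h q r" by (auto simp: P_def S_def T_def)
  qed
  then obtain h where h: "\<And>q. P h q (h q)" by blast
  have "R (h p) (h q)" if "p < q" for p q
  proof -
    have "to_nat p < to_nat q \<or> to_nat q < to_nat p"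
      using that by (metis from_nat_to_nat less_irrefl linorder_neqE_nat)
    then show ?thesis using h[of p] h[of q] that by (auto simp: P_def)
  qed
  then show thesis by (rule that)
qed

text \<open>These are the initial segments of the chain induced on \<open>C\<close>, so that
  \<open>C\<close> can be a countable part of an arbitrary underlying set.\<close>

definition segments :: "'a rel \<Rightarrow> 'a set \<Rightarrow> 'a set set" where
  "segments l C = {D. D \<subseteq> C \<and> (\<forall>x\<in>D. \<forall>y\<in>C. (y, x) \<in> l \<longrightarrow> y \<in> D)}"

text \<open>If there were uncountably many segments, the relation "uncountably many segments contain
  \<open>x\<close> but not \<open>y\<close>" would be nonempty, transitive and dense, and it implies
  \<open>x < y\<close>. A copy of \<open>eta\<close> would result.\<close>

lemma countable_segments:
  assumes lin: "linear_order_on A l" and "scattered l" and C: "countable C" "C \<subseteq> A"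
  shows "countable (segments l C)"
proof (rule ccontr)
  assume unc: "uncountable (segments l C)"
  define sep where "sep x y = {D \<in> segments l C. x \<in> D \<and> y \<notin> D}" for x y
  define R where "R x y \<longleftrightarrow> x \<in> C \<and> y \<in> C \<and> uncountable (sep x y)" for x y
  have total: "(x, y) \<in> l \<or> (y, x) \<in> l" if "x \<in> C" "y \<in> C" for x y
  proof -
    have "x \<in> A" "y \<in> A" using C that by auto
    then show ?thesis using lin
      unfolding linear_order_on_def total_on_def partial_order_on_def preorder_on_def refl_on_def
      by metis
  qed
  have anti: "x = y" if "(x, y) \<in> l" "(y, x) \<in> l" for x y
    using lin that by (auto simp: linear_order_on_def partial_order_on_def antisym_def)
  have R_less: "(x, y) \<in> l \<and> x \<noteq> y" if "R x y" for x y
  proof -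
    from that have "sep x y \<noteq> {}" by (auto simp: R_def)
    with that show ?thesis using total[of x y] by (auto simp: R_def sep_def segments_def)
  qed
  have trans: "R x z" if "R x y" "R y z" for x y z
  proof -
    have "sep x y \<subseteq> sep x z"
      using R_less[OF that(2)] that by (auto simp: sep_def segments_def R_def)
    then show ?thesis using that by (auto simp: R_def intro: countable_subset)
  qed
  have dense: "\<exists>z. R x z \<and> R z y" if xy: "R x y" for x y
  proof (rule ccontr)
    assume no: "\<nexists>z. R x z \<and> R z y"
    \<comment> \<open>A segment separating \<open>x\<close> from \<open>y\<close> is then forced, up to countably many exceptions, to be \<open>?Z\<close>.\<close>
    let ?Z = "{z \<in> C. countable (sep x z)}" and ?Y = "{z \<in> C. countable (sep z y)}"
    have "sep x y \<subseteq> insert ?Z ((\<Union>z\<in>?Z. sep x z) \<union> (\<Union>z\<in>?Y. sep z y))"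
    proof
      fix D assume D: "D \<in> sep x y"
      have "D = ?Z" if "D \<notin> (\<Union>z\<in>?Z. sep x z)" "D \<notin> (\<Union>z\<in>?Y. sep z y)"
      proof
        show "D \<subseteq> ?Z"
        proof
          \<comment> \<open>If \<open>z\<close> were not in \<open>?Z\<close>, then
            \<open>R x z\<close>, so \<open>R z y\<close> fails and \<open>z\<close> is in
            \<open>?Y\<close>; but \<open>D\<close> contains \<open>z\<close> and not
            \<open>y\<close>, so it lies in \<open>sep z y\<close>.\<close>
          fix z assume "z \<in> D"
          then show "z \<in> ?Z"
            using D that(2) no xy by (auto simp: sep_def segments_def R_def)
        qed
        show "?Z \<subseteq> D" using D that(1) by (auto simp: sep_def)
      qed
      then show "D \<in> insert ?Z ((\<Union>z\<in>?Z. sep x z) \<union> (\<Union>z\<in>?Y. sep z y))" by blast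
    qed
    moreover have "countable (insert ?Z ((\<Union>z\<in>?Z. sep x z) \<union> (\<Union>z\<in>?Y. sep z y)))"
      using C(1) by (intro countable_insert countable_Un countable_UN) auto
    ultimately have "countable (sep x y)" by (rule countable_subset)
    with xy show False by (simp add: R_def)
  qed
  have "\<exists>u v. R u v"
  proof (rule ccontr)
    assume no: "\<nexists>u v. R u v"
    have "countable (insert {} (insert C (\<Union>x\<in>C. \<Union>y\<in>C. sep x y)))"
      using C(1) no by (intro countable_insert countable_UN) (auto simp: R_def)
    \<comment> \<open>Any segment other than the empty set and \<open>C\<close> separates one of its
      points from a point outside.\<close>
    moreover have "segments l C \<subseteq> insert {} (insert C (\<Union>x\<in>C. \<Union>y\<in>C. sep x y))"
      by (auto simp: sep_def segments_def)
    ultimately show False using unc countable_subset by blast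
  qed
  then obtain u v where "R u v" by blast
  then obtain h :: "rat \<Rightarrow> 'a" where h: "\<And>p q. p < q \<Longrightarrow> R (h p) (h q)"
    using rat_into_dense_relation[of R] trans dense by metis
  have less: "(h p, h q) \<in> l \<and> h p \<noteq> h q" if "p < q" for p q
    using R_less[OF h[OF that]] .
  have "contains_copy l eta"
  proof (rule contains_copyI[where f = h])
    show "refl_on (Field eta) eta" by (auto simp: eta_def refl_on_def)
    show "inj_on h (Field eta)" using less by (intro inj_onI) (metis neq_iff)
    have hC: "h p \<in> C" for p using h[of p "p + 1"] by (simp add: R_def)
    show "(p, q) \<in> eta \<longleftrightarrow> (h p, h q) \<in> l" for p q
      using less[of p q] less[of q p] anti[of "h p" "h q"] total[OF hC hC, of p p]
      by (cases p q rule: linorder_cases) (auto simp: eta_def)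
  qed
  with \<open>scattered l\<close> show False by (simp add: scattered_def)
qed

section \<open>Ideals\<close>

text \<open>The strict bound excludes a greatest element, and \<open>F = {}\<close> excludes the empty set.\<close>

definition ideals :: "'q rel \<Rightarrow> 'q set set" where
  "ideals q = {X. (\<forall>x y. y \<in> X \<and> (x, y) \<in> q \<longrightarrow> x \<in> X) \<and>
     (\<forall>F \<subseteq> X. finite F \<longrightarrow> (\<exists>z\<in>X. \<forall>y\<in>F. (y, z) \<in> q \<and> y \<noteq> z))}"

lemma countable_ideals:
  fixes q :: "'q::countable rel"
  assumes "finite L"
    and L: "\<And>l. l \<in> L \<Longrightarrow> linear_order_on A l \<and> scattered l"
    and f: "range f \<subseteq> A"
    and q: "\<And>x y. (x, y) \<in> q \<and> x \<noteq> y \<longleftrightarrow> (\<forall>l\<in>L. (g y, f x) \<notin> l)"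
  shows "countable (ideals q)"
proof -
  \<comment> \<open>The restricted abstraction makes \<open>E X\<close> extensional, hence a member
    of the product \<open>PiE\<close>.\<close>
  define E where "E X = (\<lambda>l\<in>L. {a \<in> range f. \<exists>y\<in>X. (a, f y) \<in> l})" for X
  have trans: "(x, z) \<in> l" if "l \<in> L" "(x, y) \<in> l" "(y, z) \<in> l" for l x y z
    using L[OF that(1)] that(2,3)
    by (auto simp: linear_order_on_def partial_order_on_def preorder_on_def dest: transD)
  have refl: "(f x, f x) \<in> l" if "l \<in> L" for l x
    using L[OF that] f
    unfolding linear_order_on_def partial_order_on_def preorder_on_def refl_on_def by blast
  have "{a \<in> range f. \<exists>y\<in>X. (a, f y) \<in> l} \<in> segments l (range f)" if "l \<in> L" for l X
    unfolding segments_def using trans[OF that] by blast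
  then have "E ` ideals q \<subseteq> (\<Pi>\<^sub>E l\<in>L. segments l (range f))"
    unfolding E_def by (simp add: image_subset_iff)
  moreover have "countable (\<Pi>\<^sub>E l\<in>L. segments l (range f))"
  proof (rule countable_PiE[OF \<open>finite L\<close>])
    fix l assume "l \<in> L"
    then show "countable (segments l (range f))"
      using L[of l] f by (intro countable_segments[of A]) simp_all
  qed
  ultimately have cnt: "countable (E ` ideals q)" by (rule countable_subset)
  have recover: "X = {x. \<forall>l\<in>L. f x \<in> E X l}" if X: "X \<in> ideals q" for X
  proof
    have down: "x \<in> X" if "y \<in> X" "(x, y) \<in> q" for x y
      using X that unfolding ideals_def by blast
    have bound: "\<exists>z\<in>X. \<forall>y\<in>F. (y, z) \<in> q \<and> y \<noteq> z" if "F \<subseteq> X" "finite F" for F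
      using X that unfolding ideals_def by simp
    show "X \<subseteq> {x. \<forall>l\<in>L. f x \<in> E X l}" using refl by (auto simp: E_def)
    show "{x. \<forall>l\<in>L. f x \<in> E X l} \<subseteq> X"
    proof (intro subsetI, rule ccontr)
      fix x assume x: "x \<in> {x. \<forall>l\<in>L. f x \<in> E X l}" "x \<notin> X"
      then have "\<forall>l\<in>L. \<exists>y\<in>X. (f x, f y) \<in> l" by (auto simp: E_def)
      then obtain y where y: "\<And>l. l \<in> L \<Longrightarrow> y l \<in> X \<and> (f x, f (y l)) \<in> l" by metis
      have "finite (y ` L)" "y ` L \<subseteq> X" using \<open>finite L\<close> y by auto
      then obtain z where z: "z \<in> X" "\<And>l. l \<in> L \<Longrightarrow> (y l, z) \<in> q \<and> y l \<noteq> z"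
        using bound[of "y ` L"] by blast
      \<comment> \<open>The contradiction: \<open>x\<close> is not below \<open>z\<close>, so some
        \<open>l\<close> has \<open>g z\<close> below \<open>f x\<close>, which is below
        \<open>f (y l)\<close>. Yet \<open>y l < z\<close> forbids \<open>g z\<close> below
        \<open>f (y l)\<close>.\<close>
      have "(x, z) \<notin> q" using down z(1) x(2) by blast
      then obtain l where l: "l \<in> L" "(g z, f x) \<in> l" using q by blast
      then have "(g z, f (y l)) \<in> l" using y[OF l(1)] trans[OF l(1)] by blast
      moreover have "(g z, f (y l)) \<notin> l" using z(2)[OF l(1)] q l(1) by blast
      ultimately show False by contradiction
    qed
  qed
  have "inj_on E (ideals q)"
  proof (rule inj_onI)
    fix X Y assume "X \<in> ideals q" "Y \<in> ideals q" "E X = E Y"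
    then show "X = Y" using recover[of X] recover[of Y] by simp
  qed
  with cnt show ?thesis by (rule countable_image_inj_on)
qed

section \<open>Excluding copies of a poset and of its open split\<close>

lemma no_copy:
  fixes q :: "'q::countable rel"
  assumes "partial_order_on UNIV q" and unc: "uncountable (ideals q)"
    and "finite L"
    and L: "\<And>l. l \<in> L \<Longrightarrow> linear_order_on A l \<and> scattered l"
    and P: "partial_order_on A P" "P = A \<times> A \<inter> \<Inter>L"
  shows "\<not> contains_copy P q" and "\<not> contains_copy P (open_split q)"
proof -
  have F: "Field P \<subseteq> A" using P(2) by (auto simp: Field_def)
  have Fq: "Field q = UNIV" and refl: "(x, x) \<in> q" for x
    using assms(1) by (auto simp: partial_order_on_def preorder_on_def refl_on_def Field_def)
  have neg: "(b, a) \<notin> l \<longleftrightarrow> (a, b) \<in> l \<and> a \<noteq> b" if "l \<in> L" "a \<in> A" "b \<in> A" for a b l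
    using L[OF that(1)] that(2,3)
    unfolding linear_order_on_def total_on_def partial_order_on_def preorder_on_def
      refl_on_def antisym_def by metis
  \<comment> \<open>By totality, being strictly below in every \<open>l\<close> means that no
    \<open>l\<close> reverses the pair. For empty \<open>L\<close> the right side would be vacuously
    true.\<close>
  have less: "(a, b) \<in> P \<and> a \<noteq> b \<longleftrightarrow> (\<forall>l\<in>L. (b, a) \<notin> l)"
    if "a \<in> A" "b \<in> A" "L \<noteq> {}" for a b
    using neg[OF _ that(1,2)] that P(2) by auto
  \<comment> \<open>With \<open>L\<close> empty, \<open>P\<close> would be all of
    \<open>A \<times> A\<close>, which is not antisymmetric on two points.\<close>
  have nonempty: "L \<noteq> {}" if "a \<in> A" "b \<in> A" "a \<noteq> b" for a b
    using P that by (auto simp: partial_order_on_def antisym_def)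
  have two: "\<exists>x y :: 'q. x \<noteq> y"
  proof (rule ccontr)
    assume "\<nexists>x y :: 'q. x \<noteq> y"
    then have "X = {} \<or> X = UNIV" for X :: "'q set" by (metis UNIV_eq_I equals0I)
    then have "ideals q \<subseteq> {{}, UNIV}" by blast
    then have "finite (ideals q)" by (rule finite_subset) simp
    with unc show False by (simp add: countable_finite)
  qed
  show "\<not> contains_copy P q"
  proof
    assume "contains_copy P q"
    then obtain f where f: "inj f" "range f \<subseteq> A" "\<And>x y. (x, y) \<in> q \<longleftrightarrow> (f x, f y) \<in> P"
      using F by (auto simp: Fq elim!: contains_copyE)
    obtain x y :: 'q where "x \<noteq> y" using two by blast
    then have "L \<noteq> {}" using nonempty[of "f x" "f y"] f(1,2) by (auto simp: inj_eq)
    have "countable (ideals q)"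
    proof (rule countable_ideals[OF \<open>finite L\<close> L f(2), of q f])
      show "(x, y) \<in> q \<and> x \<noteq> y \<longleftrightarrow> (\<forall>l\<in>L. (f y, f x) \<notin> l)" for x y
        using less[of "f x" "f y"] f \<open>L \<noteq> {}\<close> by (auto simp: inj_eq)
    qed
    with unc show False ..
  qed
  show "\<not> contains_copy P (open_split q)"
  proof
    have "(p, p) \<in> open_split q" for p
      by (cases p) (simp add: open_split_def Fq Id_onI)
    then have Fs: "Field (open_split q) = UNIV" by (blast intro: FieldI1)
    assume "contains_copy P (open_split q)"
    then obtain f where f: "inj f" "range f \<subseteq> A"
      "\<And>x y. (x, y) \<in> open_split q \<longleftrightarrow> (f x, f y) \<in> P"
      using F by (auto simp: Fs elim!: contains_copyE)
    have fA: "f x \<in> A" for x using f(2) by auto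
    have neq: "f (x, False) \<noteq> f (y, True)" for x y using f(1) by (auto dest: injD)
    have "L \<noteq> {}" using nonempty[OF fA fA neq] .
    have "countable (ideals q)"
    \<comment> \<open>The lower level serves as \<open>f\<close> and the upper one as
      \<open>g\<close>: strict comparisons in \<open>q\<close> are exactly the comparisons from the
      lower to the upper level.\<close>
    proof (rule countable_ideals[OF \<open>finite L\<close> L, of "\<lambda>x. f (x, False)" q "\<lambda>x. f (x, True)"])
      show "range (\<lambda>x. f (x, False)) \<subseteq> A" using fA by auto
      show "(x, y) \<in> q \<and> x \<noteq> y \<longleftrightarrow> (\<forall>l\<in>L. (f (y, True), f (x, False)) \<notin> l)" for x y
        using less[OF fA fA \<open>L \<noteq> {}\<close>, of "(x, False)" "(y, True)"]
          f(3)[of "(x, False)" "(y, True)"] neq[of x y]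
        by (auto simp: open_split_def)
    qed
    with unc show False ..
  qed
qed

section \<open>Uncountably many ideals in \<open>eta\<close> and in the trees\<close>

text \<open>Density of the rationals in the reals is used twice: an open cut has no greatest
  element, and distinct reals have distinct cuts.\<close>

lemma uncountable_ideals_eta: "uncountable (ideals eta)"
proof
  define X where "X b = {x :: rat. of_rat x < b}" for b :: real
  have "X b \<in> ideals eta" for b
  proof -
    have "\<exists>z\<in>X b. \<forall>y\<in>F. y < z" if "finite F" "F \<subseteq> X b" for F
    proof (cases "F = {}")
      case True
      obtain z where "z < b" "z \<in> \<rat>" using Rats_dense_in_real[of "b - 1" b] by auto
      then show ?thesis using True by (auto simp: X_def elim: Rats_cases)
    next
      case False
      then have M: "Max F \<in> X b" using that Max_in by blast
      then obtain z where "of_rat (Max F) < z" "z < b" "z \<in> \<rat>"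
        using Rats_dense_in_real[of "of_rat (Max F)" b] by (auto simp: X_def)
      then obtain w where "Max F < w" "w \<in> X b"
        by (auto simp: X_def of_rat_less elim: Rats_cases)
      then show ?thesis using False that by (metis Max_less_iff)
    qed
    moreover have "x \<in> X b" if "y \<in> X b" "x \<le> y" for x y
      using that by (auto simp: X_def intro: le_less_trans of_rat_less_eq[THEN iffD2])
    ultimately show ?thesis unfolding ideals_def eta_def by (auto simp: less_le)
  qed
  moreover have "inj X"
  proof (rule linorder_injI)
    fix a b :: real assume "a < b"
    then obtain z where "a < z" "z < b" "z \<in> \<rat>" using Rats_dense_in_real by blast
    then obtain w where "w \<in> X b" "w \<notin> X a" by (auto simp: X_def elim: Rats_cases)
    then show "X a \<noteq> X b" by blast
  qed
  moreover assume "countable (ideals eta)"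
  ultimately have "countable (UNIV :: real set)"
    by (meson countable_image_inj_on countable_subset image_subsetI)
  then show False using uncountable_UNIV_real by simp
qed

text \<open>Cantor's diagonal argument.\<close>

lemma uncountable_nat_bool: "uncountable (UNIV :: (nat \<Rightarrow> bool) set)"
proof
  assume c: "countable (UNIV :: (nat \<Rightarrow> bool) set)"
  obtain n where "from_nat_into UNIV n = (\<lambda>n. \<not> from_nat_into (UNIV :: (nat \<Rightarrow> bool) set) n n)"
    using from_nat_into_surj[OF c] by blast
  then show False by (metis (full_types))
qed

text \<open>A necessary condition for comparability, preserved by each generating step: a prefix
  step leaves the truncation to \<open>length s\<close> unchanged, and a lexicographic step can only
  keep or raise it.\<close>

lemma Omega_eta_imp_lex_take:
  assumes "(s, t) \<in> Omega_eta"
  shows "length s \<le> length t \<and>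
    (s = take (length s) t \<or> (s, take (length s) t) \<in> lex {(False, True)})"
  using assms unfolding Omega_eta_def
proof (induction rule: rtrancl_induct)
  case (step t u)
  let ?l = "lex {(False, True)}" and ?k = "length s"
  have tr: "trans ?l" by (rule lex_transI) (simp add: trans_def)
  from step.hyps(2) consider "prefix t u" | "(t, u) \<in> ?l" by (auto simp: T2_def)
  then show ?case
  proof cases
    case 1
    then have "take ?k u = take ?k t" "length t \<le> length u"
      using step.IH by (auto simp: prefix_def)
    then show ?thesis using step.IH by auto
  next
    case 2
    then obtain xs as bs where tu: "t = xs @ False # as" "u = xs @ True # bs"
      "length as = length bs"
      by (auto simp: lex_conv)
    \<comment> \<open>Truncation either cuts off the first difference, leaving equal lists, or keeps
      it and with it the strict comparison.\<close>
    have "take ?k t = take ?k u \<or> (take ?k t, take ?k u) \<in> ?l"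
    proof (cases "?k \<le> length xs")
      case False
      then obtain j where "?k = length xs + Suc j"
        using less_imp_Suc_add[of "length xs" ?k] by auto
      then have "take ?k t = xs @ False # take j as" "take ?k u = xs @ True # take j bs"
        using tu by simp_all
      then show ?thesis using tu(3) by (auto intro: lex_append_leftI)
    qed (simp add: tu)
    moreover have "length u = length t" using tu by simp
    ultimately show ?thesis using step.IH transD[OF tr] by metis
  qed
qed simp

text \<open>The two inclusions treat \<open>T2\<close> and \<open>Omega_eta\<close> at once:
  \<open>T2 \<subseteq> q\<close> makes every branch a chain of \<open>q\<close>, and
  \<open>q \<subseteq> Omega_eta\<close> keeps the down-sets of different branches apart.\<close>

lemma uncountable_ideals_tree:
  assumes q: "partial_order_on UNIV q" and T: "T2 \<subseteq> q" and O: "q \<subseteq> Omega_eta"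
  shows "uncountable (ideals q)"
proof
  define br where "br b n = map b [0..<n]" for b :: "nat \<Rightarrow> bool" and n
  define X where "X b = {s. \<exists>n. (s, br b n) \<in> q}" for b
  have tr: "(x, z) \<in> q" if "(x, y) \<in> q" "(y, z) \<in> q" for x y z
    using q that by (auto simp: partial_order_on_def preorder_on_def dest: transD)
  have anti: "x = y" if "(x, y) \<in> q" "(y, x) \<in> q" for x y
    using q that by (auto simp: partial_order_on_def antisym_def)
  have len: "length (br b n) = n" for b n by (simp add: br_def)
  have take_br: "take m (br b n) = br b m" if "m \<le> n" for m n b
    using that by (simp add: br_def take_map)
  have br_mono: "(br b m, br b n) \<in> q" if "m \<le> n" for m n b
  proof -
    have "prefix (br b m) (br b n)" using take_br[OF that] take_is_prefix by metis
    then show ?thesis using T by (auto simp: T2_def)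
  qed
  have "X b \<in> ideals q" for b
  proof -
    have "\<exists>z\<in>X b. \<forall>y\<in>F. (y, z) \<in> q \<and> y \<noteq> z" if "finite F" "F \<subseteq> X b" for F
    proof -
      have "\<forall>s\<in>F. \<exists>n. (s, br b n) \<in> q" using that by (auto simp: X_def)
      then obtain n where n: "\<And>s. s \<in> F \<Longrightarrow> (s, br b (n s)) \<in> q" by metis
      obtain N where N: "\<And>s. s \<in> F \<Longrightarrow> n s < N"
        using \<open>finite F\<close> finite_nat_set_iff_bounded[of "n ` F"] by auto
      have "(s, br b N) \<in> q \<and> s \<noteq> br b N" if "s \<in> F" for s
      proof
        show "(s, br b N) \<in> q" using n[OF that] br_mono N[OF that] tr less_imp_le by metis
        show "s \<noteq> br b N"
        proof
          \<comment> \<open>Then \<open>br b N\<close> would lie both below and above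
            \<open>br b (n s)\<close>, though their lengths \<open>N\<close> and \<open>n s\<close>
            differ.\<close>
          assume "s = br b N"
          then have "br b N = br b (n s)"
            using n[OF that] br_mono[of "n s" N b] N[OF that] by (intro anti) auto
          then show False using len N[OF that] by (metis less_irrefl)
        qed
      qed
      moreover have "br b N \<in> X b" using br_mono by (auto simp: X_def)
      ultimately show ?thesis by blast
    qed
    moreover have "x \<in> X b" if "y \<in> X b" "(x, y) \<in> q" for x y
      using that tr by (auto simp: X_def)
    ultimately show ?thesis unfolding ideals_def by blast
  qed
  moreover have "inj X"
  proof (rule injI)
    fix b c assume eq: "X b = X c"
    let ?l = "lex {(False, True)}"
    \<comment> \<open>\<open>br b n\<close> lies below some \<open>br c m\<close>, and truncating
      the latter to length \<open>n\<close> gives \<open>br c n\<close>. Fresh \<open>b\<close> and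
      \<open>c\<close> allow use in both directions.\<close>
    have le: "br b n = br c n \<or> (br b n, br c n) \<in> ?l" if "X b = X c" for b c n
    proof -
      have "br b n \<in> X b" using br_mono by (auto simp: X_def)
      with that obtain m where "(br b n, br c m) \<in> Omega_eta" using O by (auto simp: X_def)
      from Omega_eta_imp_lex_take[OF this] show ?thesis by (auto simp: len take_br)
    qed
    have "br b n = br c n" for n
    proof (rule ccontr)
      assume "br b n \<noteq> br c n"
      then have "(br b n, br c n) \<in> ?l" "(br c n, br b n) \<in> ?l"
        using le[OF eq, of n] le[OF eq[symmetric], of n] by auto
      moreover have "trans ?l" by (rule lex_transI) (simp add: trans_def)
      ultimately have "(br b n, br b n) \<in> ?l" by (meson transD)
      then show False
        using lexord_irreflexive[of "{(False, True)}"] by (simp add: lexord_lex)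
    qed
    \<comment> \<open>Length \<open>Suc n\<close> is the least for which index \<open>n\<close> is
      in range.\<close>
    then have "br b (Suc n) ! n = br c (Suc n) ! n" for n by simp
    then show "b = c" by (auto simp: br_def nth_append)
  qed
  moreover assume "countable (ideals q)"
  ultimately have "countable (UNIV :: (nat \<Rightarrow> bool) set)"
    by (meson countable_image_inj_on countable_subset image_subsetI)
  then show False using uncountable_nat_bool by simp
qed

section \<open>Passing to the duals\<close>

text \<open>A copy of a dual in \<open>P\<close> is a copy of the original in
  \<open>P\<inverse>\<close>, which is the intersection of the converse orders; these are again
  linear and scattered. Thus only ideals of \<open>q\<close> itself have to be counted.\<close>

lemma no_copy_or_dual:
  fixes q :: "'q::countable rel"
  assumes q: "partial_order_on UNIV q" "uncountable (ideals q)"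
    and L: "finite L" "\<And>l. l \<in> L \<Longrightarrow> linear_order_on A l \<and> scattered l"
    and P: "partial_order_on A P" "P = A \<times> A \<inter> \<Inter>L"
  shows "\<not> contains_copy P q \<and> \<not> contains_copy P (q\<inverse>) \<and>
    \<not> contains_copy P (open_split q) \<and> \<not> contains_copy P ((open_split q)\<inverse>)"
proof -
  have "\<And>l. l \<in> converse ` L \<Longrightarrow> linear_order_on A l \<and> scattered l"
    using L(2) scattered_converse by auto
  moreover have "P\<inverse> = A \<times> A \<inter> \<Inter>(converse ` L)" "partial_order_on A (P\<inverse>)"
    using P by auto
  ultimately have "\<not> contains_copy (P\<inverse>) q" "\<not> contains_copy (P\<inverse>) (open_split q)"
    using no_copy[OF q, of "converse ` L" A "P\<inverse>"] L(1) by auto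
  moreover have "refl_on (Field q) q"
    using q(1) by (auto simp: partial_order_on_def preorder_on_def refl_on_def)
  moreover have "refl_on (Field (open_split q)) (open_split q)"
    by (auto simp: refl_on_def open_split_def Field_def)
  ultimately have "\<not> contains_copy P (q\<inverse>)" "\<not> contains_copy P ((open_split q)\<inverse>)"
    using contains_copy_converse by metis+
  with no_copy[OF q L P] show ?thesis by simp
qed

theorem theorem1:
  fixes A :: "'a set" and P :: "'a rel" and \<L> :: "'a rel set"
  assumes "partial_order_on A P"
    and "finite \<L>"
    and "\<And>l. l \<in> \<L> \<Longrightarrow> linear_order_on A l \<and> scattered l"
    and "P = (A \<times> A) \<inter> \<Inter>\<L>"
  shows "\<not> contains_copy P eta \<and> \<not> contains_copy P (eta\<inverse>) \<and>
         \<not> contains_copy P T2 \<and> \<not> contains_copy P (T2\<inverse>) \<and>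
         \<not> contains_copy P Omega_eta \<and> \<not> contains_copy P (Omega_eta\<inverse>) \<and>
         \<not> contains_copy P (open_split eta) \<and> \<not> contains_copy P ((open_split eta)\<inverse>) \<and>
         \<not> contains_copy P (open_split T2) \<and> \<not> contains_copy P ((open_split T2)\<inverse>) \<and>
         \<not> contains_copy P (open_split Omega_eta) \<and> \<not> contains_copy P ((open_split Omega_eta)\<inverse>)"
proof -
  have eta: "partial_order_on UNIV eta"
    by (auto simp: partial_order_on_def preorder_on_def refl_on_def trans_def antisym_def eta_def)
  have T2: "partial_order_on UNIV T2"
    by (auto simp: partial_order_on_def preorder_on_def refl_on_def trans_def antisym_def T2_def)
  note Omega = Omega_eta_least_order
  note no = no_copy_or_dual[OF _ _ assms(2,3,1,4)]
  show ?thesis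
    using no[OF eta uncountable_ideals_eta]
      no[OF T2 uncountable_ideals_tree[OF T2 subset_refl Omega(2)]]
      no[OF Omega(1) uncountable_ideals_tree[OF Omega(1,2) subset_refl]]
    by blast
qed

end
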